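(* Let $\varphi:\mathbb{R}^n\to\mathbb{R}$ be convex (not necessarily differentiable), let $\psi:\mathbb{R}^n\to\mathbb{R}\cup\{\infty\}$ be a closed proper convex function, and let $f:=\varphi+\psi$. Let $x_0\in\mathbb{R}^n$, let $t_k>0$ for $k=0,1,2,\dots$, and let $x_k$ be the sequence of iterates generated by the proximal subgradient method $$x_{k+1}:=\mathrm{Prox}_{t_k}(x_k-t_kg_k^\varphi),\qquad g_k^\varphi\in\partial\varphi(x_k),\qquad k=0,1,2,\dots$$ Let $g_k:=(x_k-x_{k+1})/t_k$ and $$z_k:=\frac{\sum_{i=0}^{k}t_ig_i}{\sum_{i=0}^{k}t_i},\qquad k=0,1,2,\dots$$ Then for $k=0,1,2,\dots$ $$\frac{\sum_{i=0}^{k}t_i(\varphi(x_i)+\psi(x_{i+1}))-\frac12\sum_{i=0}^{k}t_i^2\|g_i^\varphi\|^2}{\sum_{i=0}^{k}t_i}\le-f^*(z_k)+\langle z_k,x_0\rangle-\frac{\sum_{i=0}^{k}t_i}{2}\|z_k\|^2\le\min_{u\in\mathbb{R}^n}\left\{f(u)+\frac{1}{2\sum_{i=0}^{k}t_i}\|u-x_0\|^2\right\}.$$ In particular, for $k=0,1,2,\dots$ and all $x\in\mathbb{R}^n$, $$\frac{\sum_{i=0}^{k}t_i(\varphi(x_i)+\psi(x_{i+1}))-\frac12\sum_{i=0}^{k}t_i^2\|g_i^\varphi\|^2}{\sum_{i=0}^{k}t_i}\le f(x)+\frac{\|x_0-x\|^2}{2\sum_{i=0}^{k}t_i}.$$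
   Context: $\mathbb{R}^n$ is endowed with an inner product $\langle\cdot,\cdot\rangle$ and $\|\cdot\|$ is the corresponding Euclidean norm. For a convex function $h:\mathbb{R}^n\to\mathbb{R}\cup\{\infty\}$, the convex conjugate is $h^*(z)=\sup_{x\in\mathbb{R}^n}\{\langle z,x\rangle-h(x)\}$, and $\partial h$ denotes the convex subdifferential. For $t>0$ the proximal map of $\psi$ is $\mathrm{Prox}_t(x):=\arg\min_{y\in\mathbb{R}^n}\left\{\psi(y)+\frac{1}{2t}\|x-y\|^2\right\}$. By the optimality conditions for the proximal step, $x_{k+1}=x_k-t_kg_k$ where $g_k=g_k^\varphi+g_k^\psi$ for some $g_k^\psi\in\partial\psi(x_{k+1})$. *)

theory Defs
  imports "HOL-Analysis.Analysis"
begin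

text \<open>
  Functions into the reals extended by \<open>\<infinity>\<close> are functions into \<^typ>\<open>ereal\<close>; that the
  value \<open>-\<infinity>\<close> is not taken is part of \<open>proper_fun\<close>. The library's \<open>epigraph\<close> and \<open>convex_on\<close>
  are restricted to real-valued functions, hence the epigraph below; as usual it is a subset of
  the product with the (finite) reals.
\<close>

definition ereal_epigraph :: "('a \<Rightarrow> ereal) \<Rightarrow> ('a \<times> real) set"
  where "ereal_epigraph h = {(x, r). h x \<le> ereal r}"

definition convex_fun :: "('a::real_vector \<Rightarrow> ereal) \<Rightarrow> bool"
  where "convex_fun h \<longleftrightarrow> convex (ereal_epigraph h)"

definition closed_fun :: "('a::topological_space \<Rightarrow> ereal) \<Rightarrow> bool"
  where "closed_fun h \<longleftrightarrow> closed (ereal_epigraph h)"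

definition proper_fun :: "('a \<Rightarrow> ereal) \<Rightarrow> bool"
  where "proper_fun h \<longleftrightarrow> (\<forall>x. h x \<noteq> -\<infinity>) \<and> (\<exists>x. h x \<noteq> \<infinity>)"

definition convex_conjugate :: "('a::real_inner \<Rightarrow> ereal) \<Rightarrow> 'a \<Rightarrow> ereal"
  where "convex_conjugate h z = (SUP x. ereal (z \<bullet> x) - h x)"

definition subdifferential :: "('a::real_inner \<Rightarrow> ereal) \<Rightarrow> 'a \<Rightarrow> 'a set"
  where "subdifferential h x = {g. \<forall>y. h x + ereal (g \<bullet> (y - x)) \<le> h y}"

text \<open>
  \<^const>\<open>arg_min\<close> chooses some minimiser and is unspecified if there is none; for closed proper
  convex \<open>\<psi>\<close> and \<open>t > 0\<close> the minimiser exists and is unique.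
\<close>

definition prox :: "('a::real_inner \<Rightarrow> ereal) \<Rightarrow> real \<Rightarrow> 'a \<Rightarrow> 'a"
  where "prox \<psi> t x = arg_min (\<lambda>y. \<psi> y + ereal (1 / (2 * t) * (norm (x - y))\<^sup>2)) (\<lambda>_. True)"

end

(* The optimality condition of the proximal step makes g k - g\<phi> k a subgradient of \<psi> at
   x (Suc k). Adding the two subgradient inequalities at a point u, the weighted gap telescopes
   through half the squared distances from x i to u; each step leaves the error
   (t i)^2/2 (norm (g\<phi> i))^2 minus (t i)^2/2 (norm (g i - g\<phi> i))^2. This bounds z k \<bullet> u - f u uniformly
   in u, which is the bound on the conjugate; the second inequality is Fenchel-Young together with
   completing the square. *)

theory Submission
  imports Defs
begin

section \<open>Affine minorants and existence of minimisers\<close>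

text \<open>A point one unit below the graph is strictly separated from the closed convex epigraph.
  The separating hyperplane is not vertical, so it is the graph of an affine function, and that
  function is the minorant.\<close>

lemma closed_convex_fun_affine_minorant:
  fixes \<psi> :: "'a::euclidean_space \<Rightarrow> ereal"
  assumes "closed_fun \<psi>" "proper_fun \<psi>" "convex_fun \<psi>"
  obtains p b where "\<And>u. ereal (p \<bullet> u + b) \<le> \<psi> u"
proof -
  obtain v where "\<psi> v \<noteq> \<infinity>" "\<psi> v \<noteq> -\<infinity>"
    using assms(2) by (auto simp: proper_fun_def)
  then obtain m where m: "\<psi> v = ereal m" by (cases "\<psi> v") auto
  have "(v, m - 1) \<notin> ereal_epigraph \<psi>" by (simp add: ereal_epigraph_def m)
  then obtain a b where ab: "a \<bullet> (v, m - 1) < b" "\<And>w. w \<in> ereal_epigraph \<psi> \<Longrightarrow> a \<bullet> w > b"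
    using separating_hyperplane_closed_point[of "ereal_epigraph \<psi>" "(v, m - 1)"] assms
    unfolding closed_fun_def convex_fun_def by blast
  obtain q s where a: "a = (q, s)" by (cases a)
  have sep: "b < q \<bullet> u + s * r" if "\<psi> u \<le> ereal r" for u r
    using ab(2)[of "(u, r)"] that by (simp add: ereal_epigraph_def a)
  \<comment> \<open>The epigraph point \<open>(v, m)\<close> lies directly above the separated
    point, so comparing the two isolates the vertical coefficient and makes \<open>s\<close>
    positive.\<close>
  have "b < q \<bullet> v + s * m" by (rule sep) (simp add: m)
  with ab(1) have s: "s > 0" by (simp add: a algebra_simps)
  have "ereal ((- (1/s) *\<^sub>R q) \<bullet> u + b / s) \<le> \<psi> u" for u
  proof (cases "\<psi> u")
    case (real r)
    have "b < q \<bullet> u + s * r" by (rule sep) (simp add: real)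
    then have "- (q \<bullet> u) / s + b / s \<le> r" using s by (simp add: field_simps)
    then show ?thesis by (simp add: real)
  next
    case MInf
    then show ?thesis using assms(2) by (auto simp: proper_fun_def)
  qed auto
  then show thesis by (rule that)
qed

text \<open>Minimising \<open>r + q u\<close> over pairs \<open>(u, r)\<close> of the epigraph makes
  the objective continuous, with closedness of the epigraph standing in for lower semicontinuity. It
  serves both the proximal map and the minimum in the theorem.\<close>

lemma closed_fun_plus_quadratic_growth_attains_min:
  fixes \<psi> :: "'a::euclidean_space \<Rightarrow> ereal"
  assumes \<psi>: "closed_fun \<psi>" "proper_fun \<psi>" "convex_fun \<psi>"
    and q: "continuous_on UNIV q" "\<And>u. a \<bullet> u + b + c * (norm u)\<^sup>2 \<le> q u" and c: "c > 0"
  shows "\<exists>u. is_arg_min (\<lambda>u. \<psi> u + ereal (q u)) (\<lambda>_. True) u"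
proof -
  obtain p d where pd: "\<And>u. ereal (p \<bullet> u + d) \<le> \<psi> u"
    using closed_convex_fun_affine_minorant[OF \<psi>] by blast
  obtain v where "\<psi> v \<noteq> \<infinity>" "\<psi> v \<noteq> -\<infinity>"
    using \<psi>(2) by (auto simp: proper_fun_def)
  then obtain m where m: "\<psi> v = ereal m" by (cases "\<psi> v") auto
  define M where "M = m + q v"
  \<comment> \<open>The sublevel set at the value of the feasible pair \<open>(v, m)\<close>:
    nonempty, and every pair outside it is worse than this one.\<close>
  define S where "S = ereal_epigraph \<psi> \<inter> {w. snd w + q (fst w) \<le> M}"
  have cont: "continuous_on A (\<lambda>w. snd w + q (fst w))" for A :: "('a \<times> real) set"
    by (intro continuous_intros continuous_on_compose2[OF q(1)]) auto
  have "closed S"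
    unfolding S_def using \<psi>(1)
    by (intro closed_Int closed_Collect_le cont) (auto simp: closed_fun_def)
  define D where "D = norm a + norm p"
  define E where "E = \<bar>M\<bar> + \<bar>b\<bar> + \<bar>d\<bar>"
  \<comment> \<open>On \<open>S\<close> the affine minorant and the growth of \<open>q\<close> give
    \<open>c * n^2 \<le> D * n + E\<close> for the norm \<open>n\<close>. Once \<open>n > 1\<close>,
    the right side is at most \<open>(D + E) * n\<close>, which forces
    \<open>n \<le> (D + E) / c\<close>.\<close>
  define R where "R = max 1 ((D + E) / c)"
  have bnd: "norm u \<le> R \<and> \<bar>r\<bar> \<le> E + D * R" if ur: "(u, r) \<in> S" for u r
  proof -
    have "\<psi> u \<le> ereal r" using ur by (simp add: S_def ereal_epigraph_def)
    with pd[of u] have "ereal (p \<bullet> u + d) \<le> ereal r" by (rule order_trans)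
    then have r1: "p \<bullet> u + d \<le> r" by simp
    have r2: "r + q u \<le> M" using ur by (simp add: S_def)
    have ap: "\<bar>a \<bullet> u\<bar> \<le> norm a * norm u" "\<bar>p \<bullet> u\<bar> \<le> norm p * norm u"
      by (rule Cauchy_Schwarz_ineq2)+
    have sq: "c * (norm u)\<^sup>2 \<le> D * norm u + E"
      using r1 r2 q(2)[of u] ap unfolding D_def E_def by (simp add: algebra_simps)
    have nR: "norm u \<le> R"
    proof (rule ccontr)
      assume "\<not> norm u \<le> R"
      then have n: "norm u > 1" "norm u > (D + E) / c" by (auto simp: R_def)
      have "E \<ge> 0" by (simp add: E_def)
      then have "E \<le> E * norm u" using n(1) by (simp add: mult_le_cancel_left1)
      with sq have "c * norm u * norm u \<le> (D + E) * norm u"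
        by (simp add: power2_eq_square algebra_simps)
      then have "c * norm u \<le> D + E" using n(1) by (auto simp: mult_le_cancel_right)
      then show False using n(2) c by (simp add: field_simps)
    qed
    have "norm a * norm u \<le> norm a * R" "norm p * norm u \<le> norm p * R"
      "0 \<le> norm a * R" "0 \<le> norm p * R" "0 \<le> c * (norm u)\<^sup>2"
      using nR c by (auto intro!: mult_left_mono mult_nonneg_nonneg simp: R_def)
    then have "\<bar>r\<bar> \<le> E + D * R"
      using r1 r2 q(2)[of u] ap unfolding D_def E_def by (simp add: algebra_simps)
    with nR show ?thesis by simp
  qed
  have "bounded S"
  proof (rule bounded_subset)
    show "bounded (cball 0 R \<times> cball (0::real) (E + D * R))"
      by (intro bounded_Times bounded_cball)
    show "S \<subseteq> cball 0 R \<times> cball 0 (E + D * R)"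
      using bnd by auto
  qed
  with \<open>closed S\<close> have "compact S" by (simp add: compact_eq_bounded_closed)
  moreover have "(v, m) \<in> S" by (simp add: S_def ereal_epigraph_def m M_def)
  ultimately obtain w where w: "w \<in> S" "\<And>w'. w' \<in> S \<Longrightarrow> snd w + q (fst w) \<le> snd w' + q (fst w')"
    using continuous_attains_inf[OF _ _ cont[of S]] by blast
  have "\<psi> (fst w) + ereal (q (fst w)) \<le> \<psi> u + ereal (q u)" for u
  proof -
    \<comment> \<open>The minimising pair might lie above the graph; passing to the value of
      \<open>\<psi>\<close> can only decrease the objective.\<close>
    have le: "\<psi> (fst w) + ereal (q (fst w)) \<le> ereal (snd w + q (fst w))"
      using w(1) by (cases "\<psi> (fst w)") (auto simp: S_def ereal_epigraph_def)
    show ?thesis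
    proof (cases "\<psi> u")
      case (real r)
      show ?thesis
      proof (cases "r + q u \<le> M")
        case True
        then have "snd w + q (fst w) \<le> r + q u"
          using w(2)[of "(u, r)"] by (simp add: S_def ereal_epigraph_def real)
        then show ?thesis using le real by (auto intro: order_trans)
      next
        case False
        \<comment> \<open>Here the competitor lies outside \<open>S\<close>, so its value exceeds
          \<open>M\<close>, while that of \<open>w\<close> is at most \<open>M\<close>.\<close>
        then have "snd w + q (fst w) \<le> r + q u" using w(1) by (simp add: S_def)
        then show ?thesis using le real by (auto intro: order_trans)
      qed
    next
      case MInf
      then show ?thesis using \<psi>(2) by (auto simp: proper_fun_def)
    qed auto
  qed
  then show ?thesis by (auto simp: is_arg_min_def not_less)
qed

section \<open>The proximal map and its optimality condition\<close>

text \<open>Since \<open>arg_min\<close> is a choice operator, existence of a minimiser is what has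
  to be shown. Expanding the square exhibits the required affine part and quadratic growth.\<close>

lemma prox_is_arg_min:
  fixes \<psi> :: "'a::euclidean_space \<Rightarrow> ereal"
  assumes "closed_fun \<psi>" "proper_fun \<psi>" "convex_fun \<psi>" "t > 0"
  shows "is_arg_min (\<lambda>y. \<psi> y + ereal (1 / (2 * t) * (norm (w - y))\<^sup>2)) (\<lambda>_. True) (prox \<psi> t w)"
  unfolding prox_def arg_min_def
proof (rule someI_ex, rule closed_fun_plus_quadratic_growth_attains_min[OF assms(1-3)])
  show "continuous_on UNIV (\<lambda>y. 1 / (2 * t) * (norm (w - y))\<^sup>2)"
    by (intro continuous_intros)
  show "(- (1 / t) *\<^sub>R w) \<bullet> u + 1 / (2 * t) * (norm w)\<^sup>2 + 1 / (2 * t) * (norm u)\<^sup>2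
      \<le> 1 / (2 * t) * (norm (w - u))\<^sup>2" for u
    using assms(4) by (simp add: power2_norm_eq_inner inner_diff inner_commute field_simps)
  show "1 / (2 * t) > 0" using assms(4) by simp
qed

lemma prox_finite:
  fixes \<psi> :: "'a::euclidean_space \<Rightarrow> ereal"
  assumes "closed_fun \<psi>" "proper_fun \<psi>" "convex_fun \<psi>" "t > 0"
  shows "\<bar>\<psi> (prox \<psi> t w)\<bar> \<noteq> \<infinity>"
proof -
  obtain v where v: "\<psi> v \<noteq> \<infinity>" "\<psi> v \<noteq> -\<infinity>"
    using assms(2) by (auto simp: proper_fun_def)
  have "\<psi> (prox \<psi> t w) + ereal (1 / (2 * t) * (norm (w - prox \<psi> t w))\<^sup>2)
      \<le> \<psi> v + ereal (1 / (2 * t) * (norm (w - v))\<^sup>2)"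
    using prox_is_arg_min[OF assms] by (auto simp: is_arg_min_def not_less)
  then have "\<psi> (prox \<psi> t w) \<noteq> \<infinity>" using v by (cases "\<psi> v") auto
  then show ?thesis using assms(2) by (auto simp: proper_fun_def)
qed

lemma convex_funD:
  assumes "convex_fun \<psi>" "\<psi> y \<le> ereal a" "\<psi> u \<le> ereal b" "0 \<le> l" "l \<le> 1"
  shows "\<psi> (y + l *\<^sub>R (u - y)) \<le> ereal (a + l * (b - a))"
proof -
  have "(1 - l) *\<^sub>R (y, a) + l *\<^sub>R (u, b) \<in> ereal_epigraph \<psi>"
    using assms by (intro convexD) (auto simp: convex_fun_def ereal_epigraph_def)
  then show ?thesis by (simp add: ereal_epigraph_def algebra_simps)
qed

text \<open>Minimality is tested on the segment from the proximal point towards \<open>u\<close>.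
  Convexity bounds \<open>\<psi>\<close> there linearly in \<open>l\<close>, and the squared
  distance is quadratic in \<open>l\<close>; dividing by \<open>l\<close> and letting it tend to 0
  from the right leaves the subgradient inequality.\<close>

lemma prox_subdifferential:
  fixes \<psi> :: "'a::euclidean_space \<Rightarrow> ereal"
  assumes \<psi>: "closed_fun \<psi>" "proper_fun \<psi>" "convex_fun \<psi>" and t: "t > 0"
  shows "(w - prox \<psi> t w) /\<^sub>R t \<in> subdifferential \<psi> (prox \<psi> t w)"
  unfolding subdifferential_def
proof (intro CollectI allI)
  fix u
  define y where "y = prox \<psi> t w"
  obtain r where r: "\<psi> y = ereal r"
    using prox_finite[OF assms, of w] unfolding y_def by (meson abs_neq_infinity_cases)
  have min: "\<psi> y + ereal (1 / (2 * t) * (norm (w - y))\<^sup>2)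
      \<le> \<psi> u' + ereal (1 / (2 * t) * (norm (w - u'))\<^sup>2)" for u'
    using prox_is_arg_min[OF assms, of w] by (auto simp: is_arg_min_def not_less y_def)
  have "\<psi> y + ereal (((w - y) /\<^sub>R t) \<bullet> (u - y)) \<le> \<psi> u"
  proof (cases "\<psi> u")
    case (real s)
    define I where "I = (w - y) \<bullet> (u - y)"
    define N where "N = (u - y) \<bullet> (u - y)"
    have step: "r + I / t \<le> s + l * (N / (2 * t))" if l: "0 < l" "l < 1" for l :: real
    proof -
      define v where "v = y + l *\<^sub>R (u - y)"
      have "\<psi> v \<le> ereal (r + l * (s - r))"
        unfolding v_def using l r real by (intro convex_funD[OF \<psi>(3)]) auto
      moreover have "\<psi> v \<noteq> -\<infinity>" using \<psi>(2) by (simp add: proper_fun_def)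
      ultimately have "r + 1 / (2 * t) * (norm (w - y))\<^sup>2
          \<le> r + l * (s - r) + 1 / (2 * t) * (norm (w - v))\<^sup>2"
        using min[of v] r by (cases "\<psi> v") auto
      moreover have "(norm (w - v))\<^sup>2 = (norm (w - y))\<^sup>2 - 2 * l * I + l\<^sup>2 * N"
        unfolding v_def I_def N_def power2_norm_eq_inner
        by (simp add: inner_diff inner_add inner_commute power2_eq_square algebra_simps)
      ultimately have "0 \<le> l * (s - r) + 1 / (2 * t) * (l\<^sup>2 * N - 2 * l * I)"
        by (simp add: algebra_simps)
      also have "\<dots> = l * (s + l * (N / (2 * t)) - r - I / t)"
        using t by (simp add: field_simps power2_eq_square)
      finally have "0 \<le> l * (s + l * (N / (2 * t)) - r - I / t)" .
      then show ?thesis using l by (simp add: zero_le_mult_iff)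
    qed
    have "r + I / t \<le> s"
    proof (rule tendsto_lowerbound)
      have "((\<lambda>l. s + l * (N / (2 * t))) \<longlongrightarrow> s + 0 * (N / (2 * t))) (at_right 0)"
        by (intro tendsto_intros)
      then show "((\<lambda>l. s + l * (N / (2 * t))) \<longlongrightarrow> s) (at_right 0)" by simp
      show "\<forall>\<^sub>F l in at_right 0. r + I / t \<le> s + l * (N / (2 * t))"
        using step by (intro eventually_at_rightI[of 0 1]) auto
    qed simp
    then show ?thesis by (simp add: r real I_def divide_inverse mult.commute)
  next
    case MInf
    then show ?thesis using \<psi>(2) by (auto simp: proper_fun_def)
  qed auto
  then show "\<psi> (prox \<psi> t w) + ereal (((w - prox \<psi> t w) /\<^sub>R t) \<bullet> (u - prox \<psi> t w)) \<le> \<psi> u"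
    by (simp add: y_def)
qed

section \<open>The telescoping estimate and the two inequalities\<close>

text \<open>The two subgradient inequalities are based at different points, \<open>x\<close> and
  \<open>x' = x - t *\<^sub>R g\<close>. Expanding half the drop in squared distance to
  \<open>u\<close> produces both inner products and the squares of \<open>gp\<close> and
  \<open>g - gp\<close>; the latter has a favourable sign and is dropped.\<close>

lemma proximal_subgradient_step:
  fixes x x' u gp :: "'a::real_inner"
  assumes t: "t > 0" and g: "g = (x - x') /\<^sub>R t"
    and p: "p + gp \<bullet> (u - x) \<le> pu" and s: "s + (g - gp) \<bullet> (u - x') \<le> su"
  shows "t * (p + s) - 1 / 2 * (t\<^sup>2 * (norm gp)\<^sup>2)
    \<le> t * (pu + su) + ((norm (x - u))\<^sup>2 - (norm (x' - u))\<^sup>2) / 2"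
proof -
  have x': "x' = x - t *\<^sub>R g" using t g by simp
  have "p + s \<le> (pu + su) - (gp \<bullet> (u - x) + (g - gp) \<bullet> (u - x'))" using p s by simp
  then have "t * (p + s) \<le> t * ((pu + su) - (gp \<bullet> (u - x) + (g - gp) \<bullet> (u - x')))"
    using t by (intro mult_left_mono) auto
  then have "t * (p + s) \<le> t * (pu + su) - t * (gp \<bullet> (u - x) + (g - gp) \<bullet> (u - x'))"
    by (simp only: right_diff_distrib)
  moreover have "((norm (x - u))\<^sup>2 - (norm (x' - u))\<^sup>2) / 2
      = - (t * (gp \<bullet> (u - x) + (g - gp) \<bullet> (u - x'))) - 1 / 2 * (t\<^sup>2 * (norm gp)\<^sup>2)
        + 1 / 2 * (t\<^sup>2 * (norm (g - gp))\<^sup>2)"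
    unfolding x' power2_norm_eq_inner
    by (simp add: inner_diff inner_add inner_commute power2_eq_square field_simps)
  moreover have "0 \<le> 1 / 2 * (t\<^sup>2 * (norm (g - gp))\<^sup>2)" by simp
  ultimately show ?thesis by linarith
qed

theorem proposition1:
  fixes \<phi> :: "'a::euclidean_space \<Rightarrow> real"
    and \<psi> f :: "'a \<Rightarrow> ereal"
    and x g\<phi> g z :: "nat \<Rightarrow> 'a"
    and t :: "nat \<Rightarrow> real"
  assumes "convex_on UNIV \<phi>"
    and "closed_fun \<psi>" and "proper_fun \<psi>" and "convex_fun \<psi>"
    and "\<And>u. f u = ereal (\<phi> u) + \<psi> u"
    and "\<And>k. t k > 0"
    and "\<And>k. g\<phi> k \<in> subdifferential (\<lambda>u. ereal (\<phi> u)) (x k)"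
    and "\<And>k. x (Suc k) = prox \<psi> (t k) (x k - t k *\<^sub>R g\<phi> k)"
    and "\<And>k. g k = (x k - x (Suc k)) /\<^sub>R t k"
    and "\<And>k. z k = (\<Sum>i=0..k. t i *\<^sub>R g i) /\<^sub>R (\<Sum>i=0..k. t i)"
  shows
    "\<forall>k.
      ((\<Sum>i=0..k. ereal (t i) * (ereal (\<phi> (x i)) + \<psi> (x (Suc i))))
          - ereal (1 / 2 * (\<Sum>i=0..k. (t i)\<^sup>2 * (norm (g\<phi> i))\<^sup>2)))
        / ereal (\<Sum>i=0..k. t i)
      \<le> - convex_conjugate f (z k) + ereal (z k \<bullet> x 0)
          - ereal ((\<Sum>i=0..k. t i) / 2 * (norm (z k))\<^sup>2)
    \<and> (\<exists>u. is_arg_min (\<lambda>u. f u + ereal (1 / (2 * (\<Sum>i=0..k. t i)) * (norm (u - x 0))\<^sup>2))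
            (\<lambda>_. True) u)
    \<and> - convex_conjugate f (z k) + ereal (z k \<bullet> x 0)
          - ereal ((\<Sum>i=0..k. t i) / 2 * (norm (z k))\<^sup>2)
      \<le> (INF u. f u + ereal (1 / (2 * (\<Sum>i=0..k. t i)) * (norm (u - x 0))\<^sup>2))
    \<and> (\<forall>u.
        ((\<Sum>i=0..k. ereal (t i) * (ereal (\<phi> (x i)) + \<psi> (x (Suc i))))
            - ereal (1 / 2 * (\<Sum>i=0..k. (t i)\<^sup>2 * (norm (g\<phi> i))\<^sup>2)))
          / ereal (\<Sum>i=0..k. t i)
        \<le> f u + ereal ((norm (x 0 - u))\<^sup>2 / (2 * (\<Sum>i=0..k. t i))))"
proof (intro allI, goal_cases)
  case (1 k)
  note \<psi> = assms(2-4)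
  define T where "T = (\<Sum>i=0..k. t i)"
  have T: "T > 0" unfolding T_def using assms(6) by (intro sum_pos) auto
  have "\<exists>r. \<psi> (x (Suc i)) = ereal r" for i
    using prox_finite[OF \<psi> assms(6)[of i]] unfolding assms(8) by (meson abs_neq_infinity_cases)
  then obtain s where s: "\<And>i. \<psi> (x (Suc i)) = ereal (s i)" by metis
  define L where "L = ((\<Sum>i=0..k. t i * (\<phi> (x i) + s i))
      - 1 / 2 * (\<Sum>i=0..k. (t i)\<^sup>2 * (norm (g\<phi> i))\<^sup>2)) / T"
  have L: "((\<Sum>i=0..k. ereal (t i) * (ereal (\<phi> (x i)) + \<psi> (x (Suc i))))
          - ereal (1 / 2 * (\<Sum>i=0..k. (t i)\<^sup>2 * (norm (g\<phi> i))\<^sup>2))) / ereal T = ereal L"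
    using T by (simp add: s L_def)
  \<comment> \<open>This lets the last iterate be eliminated in favour of \<open>z k\<close> after
    the squared distances have been telescoped.\<close>
  have tel: "T *\<^sub>R z k = x 0 - x (Suc k)"
  proof -
    have "t i *\<^sub>R g i = x i - x (Suc i)" for i using assms(6)[of i] by (simp add: assms(9))
    then have "(\<Sum>i=0..k. t i *\<^sub>R g i) = x 0 - x (Suc k)"
      by (simp add: sum_telescope atLeast0AtMost)
    moreover have "T *\<^sub>R z k = (\<Sum>i=0..k. t i *\<^sub>R g i)"
      using T by (simp add: assms(10) flip: T_def)
    ultimately show ?thesis by simp
  qed
  have f_nMInf: "f u \<noteq> -\<infinity>" for u
    using \<psi>(2) by (cases "\<psi> u") (auto simp: assms(5) proper_fun_def)
  \<comment> \<open>Rearranged, this bounds \<open>z k \<bullet> u - fu\<close> by a quantity free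
    of \<open>u\<close>, ready for the supremum in the conjugate.\<close>
  have main: "L \<le> fu + z k \<bullet> (x 0 - u) - T / 2 * (norm (z k))\<^sup>2" if fu: "f u = ereal fu" for u fu
  proof -
    obtain su where su: "\<psi> u = ereal su" using fu by (cases "\<psi> u") (auto simp: assms(5))
    have fu_eq: "fu = \<phi> u + su" using fu by (simp add: assms(5) su)
    have "t i * (\<phi> (x i) + s i) - 1 / 2 * ((t i)\<^sup>2 * (norm (g\<phi> i))\<^sup>2)
        \<le> t i * fu + ((norm (x i - u))\<^sup>2 - (norm (x (Suc i) - u))\<^sup>2) / 2" for i
      unfolding fu_eq
    proof (rule proximal_subgradient_step[OF assms(6) assms(9)])
      show "\<phi> (x i) + g\<phi> i \<bullet> (u - x i) \<le> \<phi> u"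
        using assms(7)[of i] by (simp add: subdifferential_def)
      have "(x i - t i *\<^sub>R g\<phi> i - x (Suc i)) /\<^sub>R t i = g i - g\<phi> i"
        using assms(6)[of i] by (simp add: assms(9) algebra_simps)
      with prox_subdifferential[OF \<psi> assms(6)[of i], of "x i - t i *\<^sub>R g\<phi> i"]
      have "g i - g\<phi> i \<in> subdifferential \<psi> (x (Suc i))"
        unfolding assms(8)[symmetric] by simp
      then have "\<psi> (x (Suc i)) + ereal ((g i - g\<phi> i) \<bullet> (u - x (Suc i))) \<le> \<psi> u"
        by (simp add: subdifferential_def)
      then show "s i + (g i - g\<phi> i) \<bullet> (u - x (Suc i)) \<le> su" by (simp add: s su)
    qed
    then have "(\<Sum>i=0..k. t i * (\<phi> (x i) + s i) - 1 / 2 * ((t i)\<^sup>2 * (norm (g\<phi> i))\<^sup>2))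
        \<le> (\<Sum>i=0..k. t i * fu + ((norm (x i - u))\<^sup>2 - (norm (x (Suc i) - u))\<^sup>2) / 2)"
      by (rule sum_mono)
    also have "\<dots> = T * fu + ((norm (x 0 - u))\<^sup>2 - (norm (x (Suc k) - u))\<^sup>2) / 2"
      using sum_telescope[of "\<lambda>i. (norm (x i - u))\<^sup>2" k]
      by (simp add: sum.distrib T_def sum_distrib_right atLeast0AtMost flip: sum_divide_distrib)
    also have "(\<Sum>i=0..k. t i * (\<phi> (x i) + s i) - 1 / 2 * ((t i)\<^sup>2 * (norm (g\<phi> i))\<^sup>2)) = T * L"
      using T by (simp add: L_def sum_subtractf sum_distrib_left)
    also have "x (Suc k) = x 0 - T *\<^sub>R z k" by (simp add: tel)
    \<comment> \<open>With \<open>a = x 0 - u\<close>, half the difference of the squared norms of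
      \<open>a\<close> and \<open>a - T *\<^sub>R z k\<close> is
      \<open>T * (z k \<bullet> a) - T^2 / 2 * (norm (z k))^2\<close>, so a factor \<open>T\<close>
      splits off and cancels against \<open>T * L\<close>.\<close>
    also have "T * fu + ((norm (x 0 - u))\<^sup>2 - (norm (x 0 - T *\<^sub>R z k - u))\<^sup>2) / 2
        = T * (fu + z k \<bullet> (x 0 - u) - T / 2 * (norm (z k))\<^sup>2)"
      unfolding power2_norm_eq_inner
      by (simp add: inner_diff inner_add inner_commute field_simps)
    finally show ?thesis using T by simp
  qed
  \<comment> \<open>A point of finite value keeps the conjugate away from
    \<open>-\<infinity>\<close>, and \<open>main\<close> keeps it away from
    \<open>\<infinity>\<close>. It is therefore a real \<open>C\<close>, and the remaining
    comparisons reduce to real arithmetic.\<close>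
  obtain v where "\<psi> v \<noteq> \<infinity>" using \<psi>(2) by (auto simp: proper_fun_def)
  then obtain fv where fv: "f v = ereal fv" using f_nMInf[of v]
    by (cases "\<psi> v") (auto simp: assms(5))
  have "convex_conjugate f (z k) \<le> ereal (z k \<bullet> x 0 - T / 2 * (norm (z k))\<^sup>2 - L)"
    unfolding convex_conjugate_def
  proof (rule SUP_least)
    fix u
    show "ereal (z k \<bullet> u) - f u \<le> ereal (z k \<bullet> x 0 - T / 2 * (norm (z k))\<^sup>2 - L)"
      using main[of u] f_nMInf[of u] by (cases "f u") (auto simp: inner_diff_right)
  qed
  moreover have conj_ge: "ereal (z k \<bullet> u) - f u \<le> convex_conjugate f (z k)" for u
    unfolding convex_conjugate_def by (rule SUP_upper) simp
  ultimately obtain C where C: "convex_conjugate f (z k) = ereal C"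
    and CL: "C \<le> z k \<bullet> x 0 - T / 2 * (norm (z k))\<^sup>2 - L"
    using conj_ge[of v] fv by (cases "convex_conjugate f (z k)") auto
  have lower: "ereal L \<le> - convex_conjugate f (z k) + ereal (z k \<bullet> x 0)
      - ereal (T / 2 * (norm (z k))\<^sup>2)"
    using CL by (simp add: C)
  have upper: "- convex_conjugate f (z k) + ereal (z k \<bullet> x 0) - ereal (T / 2 * (norm (z k))\<^sup>2)
      \<le> f u + ereal (1 / (2 * T) * (norm (u - x 0))\<^sup>2)" for u
  proof (cases "f u")
    case (real fu)
    have sq: "(norm (a + T *\<^sub>R z k))\<^sup>2
        = (norm a)\<^sup>2 + 2 * T * (z k \<bullet> a) + T\<^sup>2 * (norm (z k))\<^sup>2" for a
      unfolding power2_norm_eq_inner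
      by (simp add: inner_add_left inner_add_right inner_commute power2_eq_square algebra_simps)
    \<comment> \<open>After the Fenchel inequality \<open>conj_ge\<close>, the gap that remains is
      this completed square; it vanishes at \<open>u = x 0 - T *\<^sub>R z k\<close>, which is
      \<open>x (Suc k)\<close> by \<open>tel\<close>.\<close>
    have "0 \<le> 1 / (2 * T) * (norm (u - x 0 + T *\<^sub>R z k))\<^sup>2" using T by simp
    also have "\<dots> = 1 / (2 * T) * (norm (u - x 0))\<^sup>2 + z k \<bullet> (u - x 0) + T / 2 * (norm (z k))\<^sup>2"
      unfolding sq using T by (simp add: field_simps power2_eq_square)
    finally show ?thesis using conj_ge[of u] by (simp add: C real inner_diff_right)
  qed (use f_nMInf in auto)
  have ex: "\<exists>u. is_arg_min (\<lambda>u. f u + ereal (1 / (2 * T) * (norm (u - x 0))\<^sup>2)) (\<lambda>_. True) u"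
  proof -
    have "\<exists>u. is_arg_min (\<lambda>u. \<psi> u + ereal (\<phi> u + 1 / (2 * T) * (norm (u - x 0))\<^sup>2)) (\<lambda>_. True) u"
    \<comment> \<open>The function \<open>\<phi>\<close> is absorbed into the continuous part. Being
      finite and convex it is continuous, and its subgradient at \<open>x 0\<close> supplies the
      affine lower bound that, with the square, gives quadratic growth.\<close>
    proof (rule closed_fun_plus_quadratic_growth_attains_min[OF \<psi>])
      have "continuous_on UNIV \<phi>" by (rule convex_on_continuous[OF open_UNIV assms(1)])
      then show "continuous_on UNIV (\<lambda>u. \<phi> u + 1 / (2 * T) * (norm (u - x 0))\<^sup>2)"
        by (intro continuous_intros)
      show "1 / (2 * T) > 0" using T by simp
      fix u
      have "\<phi> (x 0) + g\<phi> 0 \<bullet> (u - x 0) \<le> \<phi> u"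
        using assms(7)[of 0] by (simp add: subdifferential_def)
      moreover have "1 / (2 * T) * (norm (u - x 0))\<^sup>2
          = 1 / (2 * T) * (norm u)\<^sup>2 - (1 / T) * (x 0 \<bullet> u) + 1 / (2 * T) * (norm (x 0))\<^sup>2"
        unfolding power2_norm_eq_inner using T
        by (simp add: inner_diff inner_commute field_simps)
      ultimately show "(g\<phi> 0 - (1 / T) *\<^sub>R x 0) \<bullet> u
          + (\<phi> (x 0) - g\<phi> 0 \<bullet> x 0 + 1 / (2 * T) * (norm (x 0))\<^sup>2) + 1 / (2 * T) * (norm u)\<^sup>2
          \<le> \<phi> u + 1 / (2 * T) * (norm (u - x 0))\<^sup>2"
        by (simp add: inner_diff)
    qed
    moreover have "\<psi> u + ereal (\<phi> u + c) = f u + ereal c" for u c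
      by (cases "\<psi> u") (auto simp: assms(5))
    ultimately show ?thesis by simp
  qed
  show ?case
    unfolding T_def[symmetric] L
  proof (intro conjI allI)
    fix u
    have "ereal L \<le> f u + ereal (1 / (2 * T) * (norm (u - x 0))\<^sup>2)"
      using lower upper by (rule order_trans)
    then show "ereal L \<le> f u + ereal ((norm (x 0 - u))\<^sup>2 / (2 * T))"
      by (simp add: norm_minus_commute)
  qed (rule lower, rule ex, rule INF_greatest, rule upper)
qed

end
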